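(* Let $F$ be an ordered field with an integer part $I$, and suppose that $I\models IE_{1}$. If $\alpha\in F\setminus\mathrm{Frac}(I)$, then for every $Q\in I^{>0}$ there exist $h,k\in I$ such that $k>Q$ and $$\Big|\alpha-\frac{h}{k}\Big|<\frac{1}{k^2}.$$
   Context: A subring $I$ of an ordered field $F$ is an integer part of $F$ if $I$ is discretely ordered (no $x\in I$ satisfies $0<x<1$) and for every $x\in F$ there is $a\in I$ with $a\leqslant x<a+1$. $I^{>0}$ is the set of positive elements of $I$, and $\mathrm{Frac}(I)\subseteq F$ is its fraction field. Let $L=\{+,-,\cdot,0,1,\leqslant\}$ be the language of ordered rings. An $E_1$-formula is one of the form $\exists\bar{y}\leqslant t(\bar{x})\,\phi(\bar{x},\bar{y})$ with $\phi$ a quantifier-free $L$-formula and $t$ an $L$-term, where the bounded variables range over nonnegative elements ($0\leqslant y_i\leqslant t(\bar x)$). $IE_1$ (bounded existential induction) is the theory of discretely ordered rings together with, for each $E_1$-formula $\varphi(\vec{x},y)$, the axiom $$\forall\vec{x}\,\big(\varphi(\vec{x},0)\wedge\forall y\geqslant 0\,(\varphi(\vec{x},y)\rightarrow\varphi(\vec{x},y+1))\rightarrow\forall y\geqslant 0\,\varphi(\vec{x},y)\big).$$ *)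

theory Defs
  imports Main
begin

text \<open>The ordered field \<open>F\<close> is a type of class \<^class>\<open>linordered_field\<close>; subrings
  and integer parts of \<open>F\<close> are subsets of that type. Rings are commutative and unital.\<close>

definition is_subring :: "'a::linordered_idom set \<Rightarrow> bool" where
  "is_subring I \<longleftrightarrow> 0 \<in> I \<and> 1 \<in> I \<and>
     (\<forall>x\<in>I. - x \<in> I) \<and> (\<forall>x\<in>I. \<forall>y\<in>I. x + y \<in> I) \<and> (\<forall>x\<in>I. \<forall>y\<in>I. x * y \<in> I)"

definition discretely_ordered_ring :: "'a::linordered_idom set \<Rightarrow> bool" where
  "discretely_ordered_ring I \<longleftrightarrow> is_subring I \<and> \<not> (\<exists>x\<in>I. 0 < x \<and> x < 1)"

definition integer_part :: "'a::linordered_field set \<Rightarrow> bool" where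
  "integer_part I \<longleftrightarrow> discretely_ordered_ring I \<and> (\<forall>x. \<exists>a\<in>I. a \<le> x \<and> x < a + 1)"

definition Frac :: "'a::linordered_field set \<Rightarrow> 'a set" where
  "Frac I = {a / b | a b. a \<in> I \<and> b \<in> I \<and> b \<noteq> 0}"


text \<open>Syntax of the language of ordered rings, with equality as a logical symbol.\<close>

datatype trm =
  Var nat | Zero | One | Add trm trm | Minus trm trm | Mult trm trm

primrec vars :: "trm \<Rightarrow> nat set" where
  "vars (Var n) = {n}"
| "vars Zero = {}"
| "vars One = {}"
| "vars (Add s t) = vars s \<union> vars t"
| "vars (Minus s t) = vars s \<union> vars t"
| "vars (Mult s t) = vars s \<union> vars t"

datatype fm =
  Eq trm trm | Le trm trm | Neg fm | And fm fm | Or fm fm | Ex nat fm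

primrec qfree :: "fm \<Rightarrow> bool" where
  "qfree (Eq s t) = True"
| "qfree (Le s t) = True"
| "qfree (Neg p) = qfree p"
| "qfree (And p q) = (qfree p \<and> qfree q)"
| "qfree (Or p q) = (qfree p \<and> qfree q)"
| "qfree (Ex n p) = False"


text \<open>Tarskian semantics in the structure with universe \<open>I\<close>.\<close>

primrec eval :: "(nat \<Rightarrow> 'a) \<Rightarrow> trm \<Rightarrow> 'a::linordered_idom" where
  "eval e (Var n) = e n"
| "eval e Zero = 0"
| "eval e One = 1"
| "eval e (Add s t) = eval e s + eval e t"
| "eval e (Minus s t) = eval e s - eval e t"
| "eval e (Mult s t) = eval e s * eval e t"

primrec sat :: "'a::linordered_idom set \<Rightarrow> (nat \<Rightarrow> 'a) \<Rightarrow> fm \<Rightarrow> bool" where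
  "sat I e (Eq s t) \<longleftrightarrow> eval e s = eval e t"
| "sat I e (Le s t) \<longleftrightarrow> eval e s \<le> eval e t"
| "sat I e (Neg p) \<longleftrightarrow> \<not> sat I e p"
| "sat I e (And p q) \<longleftrightarrow> sat I e p \<and> sat I e q"
| "sat I e (Or p q) \<longleftrightarrow> sat I e p \<or> sat I e q"
| "sat I e (Ex n p) \<longleftrightarrow> (\<exists>a\<in>I. sat I (e(n := a)) p)"


text \<open>\<open>bounded_Ex ys t p\<close> is the formula \<open>\<exists>ys \<le> t. p\<close>, in which every variable in \<open>ys\<close>
  ranges over the elements between \<open>0\<close> and \<open>t\<close>. In an \<open>E\<^sub>1\<close>-formula the bounding
  term \<open>t\<close> does not mention the bounded variables.\<close>

primrec bounded_Ex :: "nat list \<Rightarrow> trm \<Rightarrow> fm \<Rightarrow> fm" where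
  "bounded_Ex [] t p = p"
| "bounded_Ex (y # ys) t p =
     Ex y (And (And (Le Zero (Var y)) (Le (Var y) t)) (bounded_Ex ys t p))"

definition E1 :: "fm set" where
  "E1 = {bounded_Ex ys t p | ys t p. distinct ys \<and> set ys \<inter> vars t = {} \<and> qfree p}"

text \<open>\<open>I \<Turnstile> IE\<^sub>1\<close>: the universally quantified parameters of an induction axiom are
  the values that the assignment \<open>e\<close> takes in \<open>I\<close> on the variables other than the
  induction variable \<open>y\<close>; substituting \<open>0\<close> or \<open>y + 1\<close> for \<open>y\<close> is rendered by
  updating \<open>e\<close>.\<close>

definition models_IE1 :: "'a::linordered_idom set \<Rightarrow> bool" where
  "models_IE1 I \<longleftrightarrow> discretely_ordered_ring I \<and>
     (\<forall>\<phi>\<in>E1. \<forall>y. \<forall>e. range e \<subseteq> I \<longrightarrow>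
        sat I (e(y := 0)) \<phi> \<longrightarrow>
        (\<forall>a\<in>I. 0 \<le> a \<longrightarrow> sat I (e(y := a)) \<phi> \<longrightarrow> sat I (e(y := a + 1)) \<phi>) \<longrightarrow>
        (\<forall>a\<in>I. 0 \<le> a \<longrightarrow> sat I (e(y := a)) \<phi>))"

end

theory Submission imports Defs
begin

text \<open>
  The classical argument runs Dirichlet's box principle and then lets the quality of the
  approximation tend to infinity. Here the second half breaks down: among the elements
  \<open>k \<le> Q\<close> of \<open>I\<close> there may be infinitely many, so the distances of the \<open>k * \<alpha>\<close> to \<open>I\<close>
  need have no positive lower bound. Farey neighbours avoid this.

  Call \<open>h/k < \<alpha> < h'/k'\<close> neighbours of \<open>\<alpha>\<close> if \<open>h' * k - h * k' = 1\<close>. Suppose that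
  \<open>k + k' > Q\<close> and that the mediant \<open>(h + h')/(k + k')\<close> lies to the left of \<open>\<alpha>\<close> (the other
  case is its mirror image). The fractions \<open>(h + j * h')/(k + j * k')\<close> increase with \<open>j\<close>
  towards \<open>h'/k'\<close>, and the last one below \<open>\<alpha>\<close>
  is found by taking an integer part; its successor exceeds \<open>\<alpha>\<close>. These two fractions are again
  neighbours, so their distance is the reciprocal of the product of their denominators, and
  the left one is the desired approximation (lemma \<open>neighbours_imp_approximation\<close>).

  It remains to find neighbours with \<open>k + k' > Q\<close>. For a rational number \<open>M/N\<close> with
  \<open>M, N \<in> I\<close> this is an \<open>E\<^sub>1\<close>-induction on the order of the Farey sequence: when the order
  reaches \<open>k + k'\<close>, the mediant replaces one of the two fractions (lemma \<open>Farey_neighbours\<close>).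
  The element \<open>\<alpha>\<close> itself cannot occur in a formula about \<open>I\<close>, but neighbours of a
  sufficiently close \<open>M/N\<close> either enclose \<open>\<alpha>\<close>, too, or can be replaced by a pair that does
  (lemma \<open>neighbours_exist\<close>).
\<close>

lemma is_subring_closed:
  assumes "is_subring I"
  shows "0 \<in> I" "1 \<in> I" "x \<in> I \<Longrightarrow> - x \<in> I"
    "x \<in> I \<Longrightarrow> y \<in> I \<Longrightarrow> x + y \<in> I" "x \<in> I \<Longrightarrow> y \<in> I \<Longrightarrow> x * y \<in> I"
    "x \<in> I \<Longrightarrow> y \<in> I \<Longrightarrow> x - y \<in> I"
proof -
  show "0 \<in> I" "1 \<in> I" and neg: "\<And>x. x \<in> I \<Longrightarrow> - x \<in> I"
    and add: "\<And>x y. x \<in> I \<Longrightarrow> y \<in> I \<Longrightarrow> x + y \<in> I" and "x \<in> I \<Longrightarrow> y \<in> I \<Longrightarrow> x * y \<in> I"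
    using assms by (auto simp: is_subring_def)
  show "x - y \<in> I" if "x \<in> I" "y \<in> I"
    using add[OF \<open>x \<in> I\<close> neg[OF \<open>y \<in> I\<close>]] by simp
qed

lemma discretely_ordered_ring_less_imp_add_one_le:
  assumes "discretely_ordered_ring I" "x \<in> I" "y \<in> I" "x < y"
  shows "x + 1 \<le> y"
proof -
  have "y - x \<in> I"
    using assms is_subring_closed(6) by (auto simp: discretely_ordered_ring_def)
  then have "\<not> (0 < y - x \<and> y - x < 1)"
    using assms(1) unfolding discretely_ordered_ring_def by blast
  then show ?thesis using assms(4) by (simp add: algebra_simps not_less)
qed


text \<open>The pair for \<open>y\<close> encloses \<open>M/N\<close> in the Farey sequence of order \<open>y + 1\<close>; this shift lets
  the induction start at \<open>0\<close> with the pair \<open>0/1\<close>, \<open>1/1\<close>. Since \<open>M/N\<close> lies in the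
  unit interval, numerators and denominators are nonnegative and bounded by \<open>y + 1\<close>, which makes
  the induction formula an \<open>E\<^sub>1\<close>-formula. The right-hand inequality is strict so that the
  mediant always falls into one of the two half-open parts.\<close>

lemma Farey_neighbours:
  assumes "models_IE1 I" and "M \<in> I" "N \<in> I" "0 \<le> M" "M < N" and "y \<in> I" "0 \<le> y"
  obtains h k h' k' where "h \<in> I" "k \<in> I" "h' \<in> I" "k' \<in> I"
    and "0 < k" "k \<le> y + 1" "0 < k'" "k' \<le> y + 1" "y + 1 < k + k'"
    and "h' * k - h * k' = 1" "h * N \<le> M * k" "M * k' < h' * N"
proof -
  have disc: "discretely_ordered_ring I" using assms(1) by (simp add: models_IE1_def)
  then have sub: "is_subring I" by (simp add: discretely_ordered_ring_def)
  note cl = is_subring_closed[OF sub]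
  \<comment> \<open>Variables 0 and 1 hold \<open>M\<close> and \<open>N\<close>, 2 is the induction variable, and 3 to 6 are
    \<open>h, k, h', k'\<close>.\<close>
  define less where "less s t = Neg (Le t s)" for s t
  define body where "body =
    And (less Zero (Var 4)) (And (less Zero (Var 6)) (And (Le (Var 3) (Var 4)) (And (Le (Var 5) (Var 6))
    (And (less (Add (Var 2) One) (Add (Var 4) (Var 6)))
    (And (Eq (Minus (Mult (Var 5) (Var 4)) (Mult (Var 3) (Var 6))) One)
    (And (Le (Mult (Var 3) (Var 1)) (Mult (Var 0) (Var 4)))
         (less (Mult (Var 0) (Var 6)) (Mult (Var 5) (Var 1)))))))))"
  define \<phi> where "\<phi> = bounded_Ex [3,4,5,6] (Add (Var 2) One) body"
  define e where "e = (\<lambda>_. 0)(0 := M, Suc 0 := N)"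
  define R where "R a h k h' k' \<longleftrightarrow> 0 < k \<and> 0 < k' \<and> h \<le> k \<and> h' \<le> k' \<and> a + 1 < k + k' \<and>
    h' * k - h * k' = 1 \<and> h * N \<le> M * k \<and> M * k' < h' * N" for a h k h' k'
  define P where "P a \<longleftrightarrow> (\<exists>h\<in>I. \<exists>k\<in>I. \<exists>h'\<in>I. \<exists>k'\<in>I. 0 \<le> h \<and> h \<le> a + 1 \<and> 0 \<le> k \<and> k \<le> a + 1 \<and>
    0 \<le> h' \<and> h' \<le> a + 1 \<and> 0 \<le> k' \<and> k' \<le> a + 1 \<and> R a h k h' k')" for a
  have E1: "\<phi> \<in> E1"
    unfolding E1_def \<phi>_def
    by (rule CollectI, intro exI conjI, rule refl) (auto simp: body_def less_def)
  have range_e: "range e \<subseteq> I" using assms cl by (auto simp: e_def)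
  have sat_P: "sat I (e(2 := a)) \<phi> \<longleftrightarrow> P a" for a
    unfolding \<phi>_def body_def less_def P_def R_def e_def by (simp add: not_le)
  have base: "P 0"
    unfolding P_def R_def using cl assms(4,5)
    by (intro bexI[of _ 0] bexI[of _ 1]) auto
  have step: "P (a + 1)" if a: "a \<in> I" "0 \<le> a" and "P a" for a
  proof -
    from \<open>P a\<close> obtain h k h' k' where I: "h \<in> I" "k \<in> I" "h' \<in> I" "k' \<in> I"
      and nonneg: "0 \<le> h" "0 \<le> h'" and le: "k \<le> a + 1" "k' \<le> a + 1" and R: "R a h k h' k'"
      unfolding P_def by blast
    have sumI: "h + h' \<in> I" "k + k' \<in> I" "a + 1 \<in> I" using I a cl by auto
    have witness: "P (a + 1)" if "h1 \<in> I" "k1 \<in> I" "h2 \<in> I" "k2 \<in> I" "0 \<le> h1" "0 \<le> h2"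
      "k1 \<le> a + 1 + 1" "k2 \<le> a + 1 + 1" "R (a + 1) h1 k1 h2 k2" for h1 k1 h2 k2
      unfolding P_def using that
      by (intro bexI[of _ h1] bexI[of _ k1] bexI[of _ h2] bexI[of _ k2])
        (auto simp: R_def intro: order.trans)
    have ge: "a + 1 + 1 \<le> k + k'"
      using discretely_ordered_ring_less_imp_add_one_le[OF disc sumI(3) sumI(2)] R
      by (auto simp: R_def)
    have Rs: "0 < k" "0 < k'" "h \<le> k" "h' \<le> k'" "h * N \<le> M * k" "M * k' < h' * N"
      using R by (simp_all add: R_def)
    then have sum_pos: "0 < k + k'" by simp
    have sum_nonneg: "0 \<le> h + h'" using nonneg by simp
    have le_Suc: "k \<le> a + 1 + 1" "k' \<le> a + 1 + 1" using le by (simp_all add: add_increasing2)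
    have det: "h' * (k + k') - (h + h') * k' = 1" "(h + h') * k - h * (k + k') = 1"
      using R by (simp_all add: R_def algebra_simps)
    have le_sum: "h + h' \<le> k + k'" using Rs by (simp add: add_mono)
    \<comment> \<open>The pair has to change only if its mediant belongs to the Farey sequence of the new order;
      the mediant then replaces the fraction on its own side of \<open>M/N\<close>.\<close>
    consider "a + 1 + 1 < k + k'"
      | "k + k' = a + 1 + 1" "(h + h') * N \<le> M * (k + k')"
      | "k + k' = a + 1 + 1" "M * (k + k') < (h + h') * N"
      using ge by fastforce
    then show "P (a + 1)"
    proof cases
      case 1
      then show ?thesis using I nonneg le R
        by (intro witness[of h k h' k']) (auto simp: R_def add.assoc intro: add_increasing2)
    next
      case 2
      have "R (a + 1) (h + h') (k + k') h' k'"
        unfolding R_def by (intro conjI sum_pos Rs le_sum det 2(2)) (simp add: 2(1)[symmetric] Rs)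
      then show ?thesis
        by (intro witness[OF sumI(1,2) I(3,4) sum_nonneg nonneg(2) eq_refl[OF 2(1)] le_Suc(2)])
    next
      case 3
      have "R (a + 1) h k (h + h') (k + k')"
        unfolding R_def by (intro conjI sum_pos Rs le_sum det 3(2)) (simp add: 3(1)[symmetric] Rs)
      then show ?thesis
        by (intro witness[OF I(1,2) sumI(1,2) nonneg(1) sum_nonneg le_Suc(1) eq_refl[OF 3(1)]])
    qed
  qed
  have "sat I (e(2 := 0)) \<phi> \<longrightarrow>
      (\<forall>a\<in>I. 0 \<le> a \<longrightarrow> sat I (e(2 := a)) \<phi> \<longrightarrow> sat I (e(2 := a + 1)) \<phi>) \<longrightarrow>
      (\<forall>a\<in>I. 0 \<le> a \<longrightarrow> sat I (e(2 := a)) \<phi>)"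
    by (rule assms(1)[unfolded models_IE1_def, THEN conjunct2, THEN bspec, OF E1,
          THEN spec, THEN spec, THEN mp, OF range_e])
  then have "P y" unfolding sat_P using base step assms(6,7) by simp
  then obtain h k h' k' where "h \<in> I" "k \<in> I" "h' \<in> I" "k' \<in> I"
    "k \<le> y + 1" "k' \<le> y + 1" "R y h k h' k'"
    unfolding P_def by auto
  then show thesis by (intro that[of h k h' k']) (simp_all add: R_def)
qed


text \<open>If \<open>M/N \<le> \<alpha> < (M + 1)/N\<close>, neighbours of \<open>M/N\<close> fail to enclose \<open>\<alpha>\<close> only when \<open>h'/k'\<close>
  lies between \<open>M/N\<close> and \<open>\<alpha>\<close>. The right neighbour \<open>a/b\<close> of \<open>h'/k'\<close> in the Farey sequence of order
  \<open>Q + 1\<close> has distance at least \<open>1/(Q + 1)\<^sup>2\<close> from \<open>h'/k'\<close>. With \<open>N = (Q + 1)\<^sup>2\<close> it therefore lies beyond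
  \<open>\<alpha>\<close>, and \<open>h'/k'\<close>, \<open>a/b\<close> are the neighbours sought.\<close>

lemma neighbours_exist:
  fixes I :: "'a::linordered_field set"
  assumes ip: "integer_part I" and IE1: "models_IE1 I" and "\<alpha> \<notin> Frac I"
    and "0 \<le> \<alpha>" "\<alpha> < 1" and "Q \<in> I" "0 < Q"
  obtains h k h' k' where "h \<in> I" "k \<in> I" "h' \<in> I" "k' \<in> I"
    and "0 < k" "0 < k'" "Q < k + k'"
    and "h' * k - h * k' = 1" "h < \<alpha> * k" "\<alpha> * k' < h'"
proof -
  have disc: "discretely_ordered_ring I" using ip by (simp add: integer_part_def)
  then have sub: "is_subring I" by (simp add: discretely_ordered_ring_def)
  note cl = is_subring_closed[OF sub]
  have irrational: "\<alpha> * b \<noteq> a" if "a \<in> I" "b \<in> I" "0 < b" for a b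
  proof
    assume "\<alpha> * b = a"
    then have "\<alpha> = a / b" using that(3) by (simp add: field_simps)
    then show False using assms(3) that unfolding Frac_def by auto
  qed
  define P where "P = Q + 1"
  have P: "P \<in> I" "0 < P" "Q < P"
    using assms(6,7) cl by (auto simp: P_def add_pos_pos)
  define N where "N = P * P"
  have N: "N \<in> I" "0 < N" using P cl by (auto simp: N_def)
  obtain M where M: "M \<in> I" "M \<le> \<alpha> * N" "\<alpha> * N < M + 1"
    using ip unfolding integer_part_def by blast
  have "0 \<le> M"
  proof (rule ccontr)
    assume "\<not> 0 \<le> M"
    then have "M + 1 \<le> 0"
      using discretely_ordered_ring_less_imp_add_one_le[OF disc M(1) cl(1)] by simp
    moreover have "0 \<le> \<alpha> * N" using assms(4) N by simp
    ultimately show False using M(3) by linarith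
  qed
  moreover have "\<alpha> * N < N" using assms(5) N(2) by simp
  then have "M < N" using M(2) by linarith
  ultimately obtain h k h' k' where I: "h \<in> I" "k \<in> I" "h' \<in> I" "k' \<in> I"
    and k: "0 < k" "k \<le> P" "0 < k'" "k' \<le> P" "P < k + k'"
    and det: "h' * k - h * k' = 1" and left: "h * N \<le> M * k" and right: "M * k' < h' * N"
    using Farey_neighbours[OF IE1 M(1) N(1) _ _ assms(6)] assms(7) unfolding P_def
    by (metis less_imp_le)
  have "M * k \<le> \<alpha> * N * k" using M(2) k(1) by (simp add: mult_right_mono)
  then have "h * N \<le> (\<alpha> * k) * N" using left by (simp add: mult_ac)
  then have h_less: "h < \<alpha> * k"
    using N(2) irrational[OF I(1,2) k(1)] by (simp add: order.strict_iff_order)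
  show thesis
  proof (cases "\<alpha> * k' < h'")
    case True
    then show thesis using that[OF I k(1) k(3) _ det h_less] P k by simp
  next
    case False
    then have h'_less: "h' < \<alpha> * k'" using irrational[OF I(3,4) k(3)] by simp
    \<comment> \<open>The fractions \<open>(j * h' - h)/(j * k' - k)\<close> are the right neighbours of \<open>h'/k'\<close>; the order
      \<open>P\<close> determines \<open>j\<close>.\<close>
    obtain j where j: "j \<in> I" "j \<le> (P + k) / k'" "(P + k) / k' < j + 1"
      using ip unfolding integer_part_def by blast
    define a where "a = j * h' - h"
    define b where "b = j * k' - k"
    have ab: "a \<in> I" "b \<in> I" using I j cl by (auto simp: a_def b_def)
    have b_le: "b \<le> P" and b_gt: "P < b + k'"
      using j k(3) by (auto simp: b_def field_simps)
    then have b_pos: "0 < b" using k(4) by linarith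
    have det': "a * k' - h' * b = 1" using det by (simp add: a_def b_def algebra_simps)
    have "N * (\<alpha> * k') < (M + 1) * k'"
      using mult_strict_right_mono[OF M(3) k(3)] by (simp add: mult_ac)
    then have "N * (\<alpha> * k' - h') < k'" using right by (simp add: algebra_simps)
    then have "b * (N * (\<alpha> * k' - h')) < b * k'"
      using b_pos by simp
    also have "b * k' \<le> N"
      unfolding N_def using b_le k P b_pos by (simp add: mult_mono)
    finally have "N * (b * (\<alpha> * k' - h')) < N * 1" by (simp add: mult_ac)
    then have "b * (\<alpha> * k' - h') < 1" using N(2) mult_less_cancel_left_pos by blast
    then have "k' * (\<alpha> * b) < k' * a" using det' by (simp add: algebra_simps)
    then have "\<alpha> * b < a" using k(3) by simp
    then show thesis using that[OF I(3,4) ab k(3) b_pos _ det' h'_less] P b_gt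
      by (simp add: add.commute)
  qed
qed


lemma neighbours_imp_approximation_below:
  fixes I :: "'a::linordered_field set"
  assumes ip: "integer_part I"
    and I: "h \<in> I" "k \<in> I" "h' \<in> I" "k' \<in> I" and k: "0 < k" "0 < k'"
    and det: "h' * k - h * k' = 1" and right: "\<alpha> * k' < h'"
    and mediant: "h + h' \<le> \<alpha> * (k + k')"
  shows "\<exists>p\<in>I. \<exists>q\<in>I. k + k' \<le> q \<and> \<bar>\<alpha> - p / q\<bar> < 1 / q ^ 2"
proof -
  have disc: "discretely_ordered_ring I" using ip by (simp add: integer_part_def)
  then have sub: "is_subring I" by (simp add: discretely_ordered_ring_def)
  note cl = is_subring_closed[OF sub]
  define d where "d = h' - \<alpha> * k'"
  have d: "0 < d" using right by (simp add: d_def)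
  \<comment> \<open>The condition \<open>(h + j * h')/(k + j * k') \<le> \<alpha>\<close> is linear in \<open>j\<close> and says \<open>j \<le> (\<alpha> * k - h)/d\<close>.\<close>
  obtain j where j: "j \<in> I" "j \<le> (\<alpha> * k - h) / d" "(\<alpha> * k - h) / d < j + 1"
    using ip unfolding integer_part_def by blast
  have "1 \<le> (\<alpha> * k - h) / d" using mediant d by (simp add: d_def algebra_simps)
  then have "0 < j" using j(3) by linarith
  then have "1 \<le> j"
    using discretely_ordered_ring_less_imp_add_one_le[OF disc cl(1) j(1)] by simp
  define p where "p = h + j * h'"
  define q where "q = k + j * k'"
  have pq: "p \<in> I" "q \<in> I" using I j cl by (auto simp: p_def q_def)
  have q_ge: "k + k' \<le> q" using \<open>1 \<le> j\<close> k by (simp add: q_def)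
  then have q_pos: "0 < q" using k by linarith
  have below: "p \<le> \<alpha> * q"
    using j(2) d by (simp add: p_def q_def d_def field_simps)
  have above: "\<alpha> * (q + k') < p + h'"
    using j(3) d by (simp add: p_def q_def d_def field_simps)
  have det': "q * (p + h') - p * (q + k') = 1"
    using det by (simp add: p_def q_def algebra_simps)
  have "q * (\<alpha> * q - p) \<le> (q + k') * (\<alpha> * q - p)"
    using below k by (intro mult_right_mono) auto
  also have "\<dots> = q * (\<alpha> * (q + k')) - p * (q + k')" by (simp add: algebra_simps)
  also have "\<dots> < q * (p + h') - p * (q + k')" using above q_pos by simp
  finally have "q * (\<alpha> * q - p) < 1" using det' by simp
  then have "q * (\<alpha> * q - p) / q ^ 2 < 1 / q ^ 2"
    using q_pos by (intro divide_strict_right_mono) auto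
  moreover have "\<alpha> - p / q = q * (\<alpha> * q - p) / q ^ 2"
    using q_pos by (simp add: field_simps power2_eq_square)
  moreover have "p / q \<le> \<alpha>" using below q_pos by (simp add: field_simps)
  ultimately have "\<bar>\<alpha> - p / q\<bar> < 1 / q ^ 2" by simp
  then show ?thesis using pq q_ge by blast
qed

text \<open>The reflection \<open>x \<mapsto> - x\<close> turns a mediant above \<open>\<alpha>\<close> into one below \<open>- \<alpha>\<close> and keeps
  the determinant, as it also exchanges the two neighbours.\<close>

lemma neighbours_imp_approximation:
  fixes I :: "'a::linordered_field set"
  assumes ip: "integer_part I"
    and I: "h \<in> I" "k \<in> I" "h' \<in> I" "k' \<in> I" and k: "0 < k" "0 < k'"
    and det: "h' * k - h * k' = 1" and left: "h < \<alpha> * k" and right: "\<alpha> * k' < h'"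
  shows "\<exists>p\<in>I. \<exists>q\<in>I. k + k' \<le> q \<and> \<bar>\<alpha> - p / q\<bar> < 1 / q ^ 2"
proof (cases "h + h' \<le> \<alpha> * (k + k')")
  case True
  then show ?thesis using neighbours_imp_approximation_below[OF ip I k det right] by blast
next
  case False
  have sub: "is_subring I" using ip by (simp add: integer_part_def discretely_ordered_ring_def)
  note cl = is_subring_closed[OF sub]
  have "\<exists>p\<in>I. \<exists>q\<in>I. k' + k \<le> q \<and> \<bar>- \<alpha> - p / q\<bar> < 1 / q ^ 2"
    using False I k det left cl
    by (intro neighbours_imp_approximation_below[OF ip, of "- h'" k' "- h" k])
      (auto simp: algebra_simps)
  then obtain p q where "p \<in> I" "q \<in> I" "k' + k \<le> q" "\<bar>- \<alpha> - p / q\<bar> < 1 / q ^ 2" by blast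
  moreover have "\<bar>\<alpha> - (- p) / q\<bar> = \<bar>- \<alpha> - p / q\<bar>"
    using abs_minus_cancel[of "- \<alpha> - p / q"] by (simp add: algebra_simps)
  ultimately show ?thesis using cl(3)[of p] by (metis add.commute)
qed


theorem corollary4p7:
  fixes I :: "'a::linordered_field set" and \<alpha> :: 'a
  assumes "integer_part I"
    and "models_IE1 I"
    and "\<alpha> \<notin> Frac I"
  shows "\<forall>Q\<in>I. Q > 0 \<longrightarrow> (\<exists>h\<in>I. \<exists>k\<in>I. k > Q \<and> \<bar>\<alpha> - h / k\<bar> < 1 / k ^ 2)"
proof (intro ballI impI)
  fix Q assume Q: "Q \<in> I" "0 < Q"
  have sub: "is_subring I"
    using assms(1) by (simp add: integer_part_def discretely_ordered_ring_def)
  note cl = is_subring_closed[OF sub]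
  obtain c where c: "c \<in> I" "c \<le> \<alpha>" "\<alpha> < c + 1"
    using assms(1) unfolding integer_part_def by blast
  have "\<alpha> - c \<notin> Frac I"
  proof
    assume "\<alpha> - c \<in> Frac I"
    then obtain a b where ab: "a \<in> I" "b \<in> I" "b \<noteq> 0" "\<alpha> - c = a / b"
      unfolding Frac_def by blast
    then have "\<alpha> = (a + c * b) / b" by (simp add: field_simps)
    moreover have "a + c * b \<in> I" using ab c cl by simp
    ultimately show False using assms(3) ab unfolding Frac_def by blast
  qed
  moreover have "0 \<le> \<alpha> - c" "\<alpha> - c < 1" using c by (simp_all add: algebra_simps)
  ultimately obtain h k h' k' where "h \<in> I" "k \<in> I" "h' \<in> I" "k' \<in> I" "0 < k" "0 < k'"
    and large: "Q < k + k'" and "h' * k - h * k' = 1" "h < (\<alpha> - c) * k" "(\<alpha> - c) * k' < h'"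
    using neighbours_exist[OF assms(1,2) _ _ _ Q] by metis
  then obtain p q where pq: "p \<in> I" "q \<in> I" "k + k' \<le> q" "\<bar>\<alpha> - c - p / q\<bar> < 1 / q ^ 2"
    using neighbours_imp_approximation[OF assms(1)] by metis
  have "Q < q" using large pq(3) by simp
  then have "\<alpha> - (p + c * q) / q = \<alpha> - c - p / q" using Q by (simp add: field_simps)
  moreover have "p + c * q \<in> I" using pq c cl by simp
  ultimately show "\<exists>h\<in>I. \<exists>k\<in>I. k > Q \<and> \<bar>\<alpha> - h / k\<bar> < 1 / k ^ 2"
    using pq \<open>Q < q\<close> by metis
qed

end
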